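(* Let $h$ and $k$ be positive integers. Then $\mathcal{T}_{\mathbb{N}}(h,k)=\mathcal{T}_{\mathbb{R}}(h,k)$. In particular, $\mathcal{R}_{\mathbb{N}}(h,k)=\mathcal{R}_{\mathbb{R}}(h,k)$.
   Context: $\mathbb{N}$ denotes the positive integers and $[k]=\{1,\dots,k\}$. For a set $A=\{a_1<\dots<a_k\}\subseteq\mathbb{R}$ and a positive integer $h$, the type of the $h$-fold addition table of $A$ is the equivalence relation on $[k]^h$ given by $(x_1,\dots,x_h)\equiv(y_1,\dots,y_h)$ if and only if $a_{x_1}+\dots+a_{x_h}=a_{y_1}+\dots+a_{y_h}$. For $X\subseteq\mathbb{R}$, $\mathcal{T}_X(h,k)$ is the set of all such types arising from sets $A\subseteq X$ with $|A|=k$, and $\mathcal{R}_X(h,k)=\{|hA| : A\subseteq X,\ |A|=k\}$, where $hA=\{a_1+\dots+a_h: a_i\in A\}$. *)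

theory Defs
  imports Complex_Main "HOL-Library.FuncSet"
begin

text \<open>
  For a finite set \<open>A = {a\<^sub>1 < \<dots> < a\<^sub>k}\<close>, \<open>nth_elem A i\<close> is \<open>a\<^sub>i\<close>. Indices start at 1;
  values at indices outside \<open>{1..k}\<close> carry no meaning and are not used.
\<close>

definition nth_elem :: "real set \<Rightarrow> nat \<Rightarrow> real" where
  "nth_elem A i = sorted_list_of_set A ! (i - 1)"

text \<open>
  Elements of \<open>[k]\<^sup>h\<close> are extensional functions from \<open>{1..h}\<close> to \<open>{1..k}\<close>, and an equivalence
  relation is its set of related pairs. Extensionality makes equality of types the equality
  of equivalence relations on \<open>[k]\<^sup>h\<close>.
\<close>

definition addition_type :: "nat \<Rightarrow> real set \<Rightarrow> ((nat \<Rightarrow> nat) \<times> (nat \<Rightarrow> nat)) set" where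
  "addition_type h A =
     {(x, y). x \<in> {1..h} \<rightarrow>\<^sub>E {1..card A} \<and> y \<in> {1..h} \<rightarrow>\<^sub>E {1..card A} \<and>
        (\<Sum>i=1..h. nth_elem A (x i)) = (\<Sum>i=1..h. nth_elem A (y i))}"

definition addition_types ::
  "real set \<Rightarrow> nat \<Rightarrow> nat \<Rightarrow> ((nat \<Rightarrow> nat) \<times> (nat \<Rightarrow> nat)) set set" where
  "addition_types X h k = {addition_type h A | A. A \<subseteq> X \<and> finite A \<and> card A = k}"

definition hfold_sumset :: "nat \<Rightarrow> real set \<Rightarrow> real set" where
  "hfold_sumset h A = {(\<Sum>i=1..h. a i) | a. \<forall>i\<in>{1..h}. a i \<in> A}"

definition sumset_sizes :: "real set \<Rightarrow> nat \<Rightarrow> nat \<Rightarrow> nat set" where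
  "sumset_sizes X h k = {card (hfold_sumset h A) | A. A \<subseteq> X \<and> finite A \<and> card A = k}"

text \<open>The positive integers, as a set of reals (\<open>\<nat>\<close> itself contains 0).\<close>

definition pos_nats :: "real set" where
  "pos_nats = \<nat> - {0}"

lemma strict_mono_on_nth_elem:
  assumes "finite A"
  shows "strict_mono_on {1..card A} (nth_elem A)"
proof (rule strict_mono_onI)
  fix r s assume "r \<in> {1..card A}" "s \<in> {1..card A}" "r < s"
  then show "nth_elem A r < nth_elem A s"
    using assms unfolding nth_elem_def
    by (intro sorted_wrt_nth_less[OF strict_sorted_list_of_set]) auto
qed

lemma nth_elem_image:
  assumes "finite A"
  shows "nth_elem A ` {1..card A} = A"
proof -
  have "{1..card A} = Suc ` {..<card A}"
    by (simp add: image_Suc_lessThan)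
  then have "nth_elem A ` {1..card A} = (\<lambda>i. sorted_list_of_set A ! i) ` {..<card A}"
    by (simp add: image_image nth_elem_def del: image_Suc_lessThan)
  also have "\<dots> = set (sorted_list_of_set A)"
    by (auto simp: set_conv_nth)
  finally show ?thesis
    using assms by simp
qed

lemma equiv_addition_type:
  "equiv ({1..h} \<rightarrow>\<^sub>E {1..card A}) (addition_type h A)"
  by (rule equivI) (auto simp: addition_type_def intro!: refl_onI symI transI)

end

theory Submission
  imports Defs "HOL-Analysis.Kronecker_Approximation_Theorem"
begin

text \<open>
  Rescale and translate a real set so that distinct \<open>h\<close>-fold sums differ by at least 1 and all
  elements are at least 1. By Dirichlet's theorem some positive integer multiple \<open>q\<close> brings all
  elements within \<open>1/(4h)\<close> of integers, so every \<open>h\<close>-fold sum moves by at most 1/4 under rounding.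
  Equal sums thus go to integers at distance at most 1/2, which are equal, and distinct sums, being
  at least \<open>q\<close> apart, keep their order; on constant tuples this says that the elements keep their
  order. The size of the sumset is the number of classes of the type.
\<close>

lemma positive_integers_with_same_order_of_sums:
  fixes f :: "nat \<Rightarrow> real" and h k :: nat
  assumes "h > 0"
  obtains p :: "nat \<Rightarrow> int" where
    "\<And>i. i \<in> {1..k} \<Longrightarrow> p i > 0"
    "\<And>x y. x \<in> {1..h} \<rightarrow>\<^sub>E {1..k} \<Longrightarrow> y \<in> {1..h} \<rightarrow>\<^sub>E {1..k} \<Longrightarrow>
       (\<Sum>i=1..h. p (x i)) < (\<Sum>i=1..h. p (y i)) \<longleftrightarrow> (\<Sum>i=1..h. f (x i)) < (\<Sum>i=1..h. f (y i))"
proof -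
  let ?P = "{1..h} \<rightarrow>\<^sub>E {1..k}"
  define S where "S x = (\<Sum>i=1..h. f (x i))" for x
  \<comment> \<open>Inserting 1 keeps the set nonempty even when all sums agree; removing 0 makes
    its minimum positive.\<close>
  define D where "D = insert 1 ((\<lambda>(x, y). \<bar>S x - S y\<bar>) ` (?P \<times> ?P) - {0})"
  have "finite ?P"
    by (intro finite_PiE) auto
  then have fin: "finite D"
    by (simp add: D_def)
  define d where "d = Min D"
  have "d \<in> D"
    unfolding d_def by (rule Min_in[OF fin]) (simp add: D_def)
  then have d: "d > 0"
    by (auto simp: D_def)
  have gap: "S y - S x \<ge> d" if "x \<in> ?P" "y \<in> ?P" "S x < S y" for x y
  proof -
    have "\<bar>S y - S x\<bar> \<in> D"
      using that unfolding D_def by (intro insertI2 DiffI image_eqI[of _ _ "(y, x)"]) auto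
    then show ?thesis
      using Min_le[OF fin] that(3) by (fastforce simp: d_def)
  qed
  \<comment> \<open>The sum in \<open>t\<close> dominates every \<open>\<bar>f i\<bar> / d\<close>,
    which forces \<open>\<theta> i \<ge> 1\<close>. Translation adds the same \<open>h * t\<close>
    to all sums, so their comparisons are unaffected.\<close>
  define t where "t = 1 + (\<Sum>i=1..k. \<bar>f i\<bar> / d)"
  define \<theta> where "\<theta> i = f i / d + t" for i
  have \<theta>_ge: "\<theta> i \<ge> 1" if "i \<in> {1..k}" for i
  proof -
    have "\<bar>f i\<bar> / d \<le> (\<Sum>i=1..k. \<bar>f i\<bar> / d)"
      using that d by (intro member_le_sum) auto
    moreover have "- (\<bar>f i\<bar> / d) \<le> f i / d"
      using d by (simp add: field_simps)
    ultimately show ?thesis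
      by (simp add: \<theta>_def t_def)
  qed
  have "4 * h > 0"
    using assms by simp
  \<comment> \<open>The choice \<open>N = 4 * h\<close> keeps the total error over \<open>h\<close>
    summands within 1/4. Indices of the approximation start at 0, so reaching index \<open>k\<close>
    takes \<open>Suc k\<close> of them.\<close>
  then obtain q :: int and p where q: "q > 0"
    and p: "\<And>i. i < Suc k \<Longrightarrow> \<bar>of_int q * \<theta> i - of_int (p i)\<bar> < 1 / real (4 * h)"
    using Dirichlet_approx_simult[where N = "4 * h" and n = "Suc k" and \<theta> = \<theta>] by metis
  have q1: "real_of_int q \<ge> 1"
    using q by linarith
  have pos: "p i > 0" if "i \<in> {1..k}" for i
  proof -
    have "1 / real (4 * h) < 1"
      using assms by simp
    moreover have "1 \<le> of_int q * \<theta> i"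
      using mult_mono[OF q1 \<theta>_ge[OF that]] q1 by simp
    ultimately have "real_of_int (p i) > 0"
      using p[of i] that by auto
    then show ?thesis
      by simp
  qed
  define T where "T x = (\<Sum>i=1..h. p (x i))" for x
  \<comment> \<open>\<open>S x / d + h * t\<close> is the sum of the \<open>\<theta> (x i)\<close>,
    so the difference is the accumulated rounding error.\<close>
  have close: "\<bar>of_int q * (S x / d + h * t) - of_int (T x)\<bar> \<le> 1 / 4" if x: "x \<in> ?P" for x
  proof -
    have "of_int q * (S x / d + h * t) - of_int (T x) = (\<Sum>i=1..h. of_int q * \<theta> (x i) - of_int (p (x i)))"
      by (simp add: S_def T_def \<theta>_def sum.distrib sum_subtractf sum_distrib_left sum_divide_distrib
          distrib_left)
    also have "\<bar>\<dots>\<bar> \<le> (\<Sum>i=1..h. 1 / real (4 * h))"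
    proof (rule order_trans[OF sum_abs sum_mono])
      fix i assume "i \<in> {1..h}"
      then have "x i < Suc k"
        using PiE_mem[OF x] by fastforce
      then show "\<bar>of_int q * \<theta> (x i) - of_int (p (x i))\<bar> \<le> 1 / real (4 * h)"
        using p by (meson less_imp_le)
    qed
    also have "\<dots> = 1 / 4"
      using assms by simp
    finally show ?thesis .
  qed
  have "T x < T y \<longleftrightarrow> S x < S y" if x: "x \<in> ?P" and y: "y \<in> ?P" for x y
  proof
    \<comment> \<open>Since \<open>q \<ge> 1\<close>, the rescaled sums stay at least 1 apart, and
      the two rounding errors consume at most 1/2 of that gap.\<close>
    assume "S x < S y"
    then have "1 \<le> (S y - S x) / d"
      using gap[OF x y] d by simp
    then have "1 \<le> of_int q * ((S y - S x) / d)"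
      using mult_mono[OF q1, of 1] q1 by fastforce
    then have "1 \<le> of_int q * (S y / d + h * t) - of_int q * (S x / d + h * t)"
      by (simp add: algebra_simps diff_divide_distrib)
    then have "real_of_int (T x) < of_int (T y)"
      using close[OF x] close[OF y] by linarith
    then show "T x < T y"
      by simp
  next
    assume "T x < T y"
    show "S x < S y"
    \<comment> \<open>Otherwise the errors leave \<open>T y\<close> at most 1/2 above
      \<open>T x\<close>, whereas integers with \<open>T x < T y\<close> differ by at least
      1.\<close>
    proof (rule ccontr)
      assume "\<not> S x < S y"
      then have "of_int q * (S y / d + h * t) \<le> of_int q * (S x / d + h * t)"
        using d q by (intro mult_left_mono add_right_mono divide_right_mono) auto
      then have "real_of_int (T y) \<le> of_int (T x) + 1 / 2"
        using close[OF x] close[OF y] by linarith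
      then show False
        using \<open>T x < T y\<close> by linarith
    qed
  qed
  with that[of p] pos show thesis
    by (simp add: S_def T_def)
qed

text \<open>A strictly increasing list is determined by its set of entries, so listing the values of
  \<open>b\<close> in index order already gives the sorted list of its image.\<close>

lemma nth_elem_image_strict_mono_on:
  assumes "strict_mono_on {1..k} b" "i \<in> {1..k}"
  shows "nth_elem (b ` {1..k}) i = b i"
proof -
  have "sorted_wrt (<) (map b [1..<Suc k])"
    using assms(1) by (auto simp: sorted_wrt_map sorted_wrt_iff_nth_less strict_mono_on_def
        simp del: upt_Suc)
  moreover have "set (map b [1..<Suc k]) = b ` {1..k}"
    by (simp only: set_map set_upt atLeastLessThanSuc_atLeastAtMost)
  ultimately have "sorted_list_of_set (b ` {1..k}) = map b [1..<Suc k]"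
    by (intro strict_sorted_equal) auto
  then show ?thesis
    using assms(2) by (auto simp: nth_elem_def nth_append simp del: upt_Suc)
qed

text \<open>The order of sums serves twice: on constant tuples it makes the integers increase with
  the index, which fixes the cardinality and enumeration of \<open>B\<close>; compared in both
  directions it preserves equality of sums, hence the type.\<close>

lemma addition_type_realized_in_pos_nats:
  assumes "h > 0" "finite A"
  obtains B where "B \<subseteq> pos_nats" "finite B" "card B = card A"
    "addition_type h B = addition_type h A"
proof -
  let ?k = "card A"
  let ?P = "{1..h} \<rightarrow>\<^sub>E {1..?k}"
  obtain p :: "nat \<Rightarrow> int" where pos: "\<And>i. i \<in> {1..?k} \<Longrightarrow> p i > 0"
    and p: "\<And>x y. x \<in> ?P \<Longrightarrow> y \<in> ?P \<Longrightarrow> (\<Sum>i=1..h. p (x i)) < (\<Sum>i=1..h. p (y i)) \<longleftrightarrow>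
       (\<Sum>i=1..h. nth_elem A (x i)) < (\<Sum>i=1..h. nth_elem A (y i))"
    using positive_integers_with_same_order_of_sums[OF assms(1), where k = ?k and f = "nth_elem A"] by blast
  define b where "b i = real_of_int (p i)" for i
  define B where "B = b ` {1..?k}"
  have mono: "strict_mono_on {1..?k} b"
  proof (rule strict_mono_onI)
    fix r s assume rs: "r \<in> {1..?k}" "s \<in> {1..?k}" "r < s"
    then have "nth_elem A r < nth_elem A s"
      by (rule strict_mono_onD[OF strict_mono_on_nth_elem[OF assms(2)]])
    \<comment> \<open>For constant tuples both sums are \<open>h\<close> times a single value, and
      \<open>h > 0\<close> lets the factor cancel.\<close>
    then have "p r < p s"
      using p[of "\<lambda>i\<in>{1..h}. r" "\<lambda>i\<in>{1..h}. s"] rs assms(1) by simp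
    then show "b r < b s"
      by (simp add: b_def)
  qed
  have card: "card B = ?k"
    unfolding B_def using strict_mono_on_imp_inj_on[OF mono] by (simp add: card_image)
  have nth: "(\<Sum>i=1..h. nth_elem B (x i)) = real_of_int (\<Sum>i=1..h. p (x i))" if "x \<in> ?P" for x
    unfolding B_def of_int_sum b_def[symmetric]
    using that by (intro sum.cong nth_elem_image_strict_mono_on[OF mono]) auto
  have eq: "(\<Sum>i=1..h. nth_elem B (x i)) = (\<Sum>i=1..h. nth_elem B (y i)) \<longleftrightarrow>
      (\<Sum>i=1..h. nth_elem A (x i)) = (\<Sum>i=1..h. nth_elem A (y i))" if "x \<in> ?P" "y \<in> ?P" for x y
    unfolding nth[OF that(1)] nth[OF that(2)] of_int_eq_iff
    using p[OF that] p[OF that(2) that(1)] by linarith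
  have "addition_type h B = addition_type h A"
    using eq unfolding addition_type_def card by auto
  moreover have "B \<subseteq> pos_nats"
    using pos by (force simp: B_def b_def pos_nats_def Nats_altdef2)
  ultimately show thesis
    using that[of B] card by (simp add: B_def)
qed

text \<open>The classes of the type are the fibres of the map sending a tuple to its sum, and the
  values of that map form the sumset.\<close>

lemma card_hfold_sumset:
  assumes "finite A"
  shows "card (hfold_sumset h A) = card (({1..h} \<rightarrow>\<^sub>E {1..card A}) // addition_type h A)"
proof -
  let ?P = "{1..h} \<rightarrow>\<^sub>E {1..card A}"
  define S where "S x = (\<Sum>i=1..h. nth_elem A (x i))" for x
  define F where "F s = {y \<in> ?P. S y = s}" for s
  have "hfold_sumset h A = S ` ?P"
  proof (intro equalityI subsetI)
    fix s assume "s \<in> hfold_sumset h A"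
    then obtain a where s: "s = (\<Sum>i=1..h. a i)" and a: "\<forall>i\<in>{1..h}. a i \<in> A"
      by (auto simp: hfold_sumset_def)
    have "\<forall>i\<in>{1..h}. \<exists>j\<in>{1..card A}. a i = nth_elem A j"
      using a nth_elem_image[OF assms] by blast
    then obtain x where x: "\<forall>i\<in>{1..h}. x i \<in> {1..card A} \<and> a i = nth_elem A (x i)"
      by metis
    \<comment> \<open>Restriction makes the chosen index function extensional without changing the
      sum.\<close>
    then have "s = S (restrict x {1..h})"
      by (simp add: s S_def)
    moreover have "restrict x {1..h} \<in> ?P"
      using x by auto
    ultimately show "s \<in> S ` ?P"
      by blast
  next
    fix s assume "s \<in> S ` ?P"
    then obtain x where x: "x \<in> ?P" "s = S x"
      by blast
    then have "\<forall>i\<in>{1..h}. nth_elem A (x i) \<in> A"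
      using nth_elem_image[OF assms] by blast
    then show "s \<in> hfold_sumset h A"
      unfolding hfold_sumset_def x(2) S_def by (intro CollectI exI[of _ "\<lambda>i. nth_elem A (x i)"]) simp
  qed
  moreover have "?P // addition_type h A = F ` S ` ?P"
  proof -
    have "addition_type h A `` {x} = F (S x)" if "x \<in> ?P" for x
      using that by (auto simp: addition_type_def F_def S_def)
    then show ?thesis
      by (auto simp: quotient_def)
  qed
  \<comment> \<open>Fibres over attained values are nonempty, so each determines its value.\<close>
  moreover have "inj_on F (S ` ?P)"
    by (rule inj_onI) (auto simp: F_def)
  ultimately show ?thesis
    by (simp add: card_image)
qed

text \<open>The size of a sumset depends on the set only through its type, so equality of the
  families of types passes to the families of sizes.\<close>

lemma sumset_sizes_eq_image_addition_types:
  "sumset_sizes X h k = (\<lambda>R. card (({1..h} \<rightarrow>\<^sub>E {1..k}) // R)) ` addition_types X h k"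
proof -
  have "sumset_sizes X h k = (\<lambda>A. card (hfold_sumset h A)) ` {A. A \<subseteq> X \<and> finite A \<and> card A = k}"
    by (simp only: sumset_sizes_def setcompr_eq_image)
  also have "\<dots> = (\<lambda>A. card (({1..h} \<rightarrow>\<^sub>E {1..k}) // addition_type h A)) `
      {A. A \<subseteq> X \<and> finite A \<and> card A = k}"
    by (intro image_cong refl) (clarsimp simp only: mem_Collect_eq card_hfold_sumset)
  also have "\<dots> = (\<lambda>R. card (({1..h} \<rightarrow>\<^sub>E {1..k}) // R)) ` addition_types X h k"
    by (simp only: addition_types_def setcompr_eq_image image_image)
  finally show ?thesis .
qed

theorem theorem3:
  fixes h k :: nat
  assumes "h > 0" and "k > 0"
  shows "addition_types pos_nats h k = addition_types (UNIV :: real set) h k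
    \<and> sumset_sizes pos_nats h k = sumset_sizes (UNIV :: real set) h k"
proof -
  have "addition_types pos_nats h k = addition_types UNIV h k"
  proof (intro equalityI subsetI)
    fix R assume "R \<in> addition_types UNIV h k"
    then obtain A where A: "finite A" "card A = k" "R = addition_type h A"
      by (auto simp: addition_types_def)
    obtain B where "B \<subseteq> pos_nats" "finite B" "card B = card A" "addition_type h B = addition_type h A"
      by (rule addition_type_realized_in_pos_nats[OF assms(1) A(1)])
    then show "R \<in> addition_types pos_nats h k"
      unfolding addition_types_def A(3) using A(2) by (intro CollectI exI[of _ B]) simp
  qed (auto simp: addition_types_def)
  then show ?thesis
    by (simp add: sumset_sizes_eq_image_addition_types)
qed

end
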